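(* Let $w$ be a Bergman weight whose moments satisfy $$\frac{h_{2m}}{h_{2(m-1)}}\geq \frac{m}{m+1}\cdot\frac{h_{2(m+1)}}{h_{2m}}\qquad\text{for all integers } m\geq 1.$$ Then for every $n\in\mathbb{N}$, $n\ge 1$, and every $r\in(0,1)$ the following equivalence holds: $$\|f_r\|_{A^{2n}(w)}\leq \|f\|_{A^2(w)}\ \text{ for every } f\in A^2(w)\quad\Longleftrightarrow\quad r\leq \frac{1}{\sqrt{n}}.$$
   Context: $\mathbb{D}$ is the open unit disk in $\mathbb{C}$ and $A$ denotes planar Lebesgue measure. A Bergman weight is a summable (integrable) nonnegative function $w$ on $[0,1)$. Its moments are $h_m=\int_0^1\rho^{m+1}w(\rho)\,d\rho$ for integers $m\geq 0$, and the normalization $h_0=1$ is always assumed. For $0<p<\infty$, a function $f$ analytic in $\mathbb{D}$ belongs to the weighted Bergman space $A^p(w)$ if $$\|f\|_{A^p(w)}:=\left(\frac{1}{2\pi}\int_{\mathbb{D}}|f(z)|^p\,w(|z|)\,dA(z)\right)^{1/p}<\infty .$$ For $r\in(0,1)$, $f_r(z)=f(rz)$. *)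

theory Defs
  imports "HOL-Complex_Analysis.Complex_Analysis"
begin

definition weight_moment :: "(real \<Rightarrow> real) \<Rightarrow> nat \<Rightarrow> real" where
  "weight_moment w m = (LINT \<rho>:{0..<1}|lebesgue. \<rho> ^ (m + 1) * w \<rho>)"

text \<open>
  A Bergman weight is only relevant on \<open>[0,1)\<close>; values of \<open>w\<close> elsewhere are never used.
  The normalization \<open>h\<^sub>0 = 1\<close> is part of the definition.
\<close>

definition bergman_weight :: "(real \<Rightarrow> real) \<Rightarrow> bool" where
  "bergman_weight w \<longleftrightarrow>
     (\<forall>\<rho>\<in>{0..<1}. 0 \<le> w \<rho>) \<and>
     set_integrable lebesgue {0..<1} w \<and>
     weight_moment w 0 = 1"

text \<open>
  The integrand below is nonnegative and measurable for a Bergman weight \<open>w\<close> and a holomorphic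
  \<open>f\<close>, so integrability is exactly finiteness of the defining integral.
\<close>

definition bergman_space :: "(real \<Rightarrow> real) \<Rightarrow> real \<Rightarrow> (complex \<Rightarrow> complex) set" where
  "bergman_space w p =
     {f. f holomorphic_on ball 0 1 \<and>
         set_integrable lebesgue (ball 0 1) (\<lambda>z. cmod (f z) powr p * w (cmod z))}"

text \<open>
  Being a Bochner integral, this has the intended value only for \<open>f\<close> in the space; outside it the
  norm is \<open>\<infinity>\<close> mathematically, so upper bounds on it must be paired with membership.
\<close>

definition bergman_norm :: "(real \<Rightarrow> real) \<Rightarrow> real \<Rightarrow> (complex \<Rightarrow> complex) \<Rightarrow> real" where
  "bergman_norm w p f =
     (1 / (2 * pi) * (LINT z:ball 0 1|lebesgue. cmod (f z) powr p * w (cmod z))) powr (1 / p)"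

definition dilation :: "real \<Rightarrow> (complex \<Rightarrow> complex) \<Rightarrow> complex \<Rightarrow> complex" where
  "dilation r f = (\<lambda>z. f (complex_of_real r * z))"

end

theory Submission
  imports Defs
begin

text \<open>
  Write \<open>f z = \<Sum>k. a k * z ^ k\<close> and \<open>c k = weight_moment w (2 * k)\<close>. The monomials are
  orthogonal for a radial weight, so the squared norm of \<open>f\<close> for the exponent \<open>2\<close> is \<open>\<Sum>k. c k * (cmod (a k))\<^sup>2\<close>
  (lemma \<open>parseval\<close>). For the exponent \<open>2 * n\<close> the same identity, Parseval's, applies to the \<open>n\<close>-th power of
  the dilated function and gives \<open>\<Sum>k. c k * r ^ (2 * k) * (cmod (A k))\<^sup>2\<close>, where \<open>A k\<close> are the
  coefficients of \<open>f ^ n\<close> (lemma \<open>dilation_power_parseval\<close>). The theorem thus compares two sums of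
  coefficients.

  For \<open>r \<le> 1 / sqrt n\<close>, the hypothesis on the moments says that \<open>c k / k!\<close> is log-concave,
  whence \<open>c (i + j) \<le> ((i + j) choose i) * c i * c j\<close>. With this, the Cauchy--Schwarz inequality
  and the binomial theorem show that \<open>\<Sum>k. c k * (cmod (A k))\<^sup>2 / n ^ k\<close> is at most the
  \<open>n\<close>-th power of \<open>\<Sum>k. c k * (cmod (a k))\<^sup>2\<close>, by induction on \<open>n\<close>
  (\<open>weighted_convolution_bound\<close>, \<open>weighted_power_coefficient_bound\<close>).

  Conversely, for \<open>f z = 1 + \<epsilon> * z\<close> the \<open>2 * n\<close>-th power of the left norm is at least
  \<open>1 + n\<^sup>2 * r\<^sup>2 * c 1 * \<epsilon>\<^sup>2\<close>, and that of the right norm is \<open>(1 + c 1 * \<epsilon>\<^sup>2) ^ n\<close>. Letting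
  \<open>\<epsilon>\<close> tend to \<open>0\<close> forces \<open>n\<^sup>2 * r\<^sup>2 \<le> n\<close>.

  The measure-theoretic part replaces \<open>w (cmod z) / (2 * pi)\<close> by a rotation-invariant Borel
  measure on the disc (\<open>bergman_measure_exists\<close>); rotation invariance yields the orthogonality of
  the monomials, and the image of area under \<open>cmod\<close> yields their norms.
\<close>

section \<open>Weighted coefficient inequalities\<close>

text \<open>
  The condition on ratios says that \<open>b k = c k / k!\<close> is log-concave: its successive quotients
  \<open>q k\<close> decrease. As \<open>b 0 = 1\<close>, comparing the product of \<open>q i, \<dots>, q (i + j - 1)\<close> with
  the product of \<open>q 0, \<dots>, q (j - 1)\<close> gives \<open>b (i + j) \<le> b i * b j\<close>.
\<close>

lemma binomially_supermultiplicative: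
  fixes c :: "nat \<Rightarrow> real"
  assumes pos: "\<And>k. 0 < c k" and c0: "c 0 = 1"
    and ratio: "\<And>m. m \<ge> 1 \<Longrightarrow> c m / c (m - 1) \<ge> real m / (real m + 1) * (c (m + 1) / c m)"
  shows "c (i + j) \<le> real ((i + j) choose i) * c i * c j"
proof -
  define q where "q m = c (Suc m) / (real (Suc m) * c m)" for m
  have q_pos: "0 < q m" for m by (simp add: q_def pos)
  have step: "q (Suc m) \<le> q m" for m
  proof -
    have "c (Suc m) / c m \<ge> real (Suc m) / (real (Suc m) + 1) * (c (Suc (Suc m)) / c (Suc m))"
      using ratio[of "Suc m"] by simp
    then have "real (Suc m) / (real (Suc m) + 1) * (c (Suc (Suc m)) / c (Suc m)) / real (Suc m)
        \<le> c (Suc m) / c m / real (Suc m)"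
      by (rule divide_right_mono) simp
    moreover have "q (Suc m)
        = real (Suc m) / (real (Suc m) + 1) * (c (Suc (Suc m)) / c (Suc m)) / real (Suc m)"
    proof -
      have "s / (s + 1) * (u / t) / s = u / ((s + 1) * t)" if "0 < s" for s t u :: real
        using that by simp
      from this[of "real (Suc m)"] show ?thesis by (simp add: q_def add.commute)
    qed
    ultimately show ?thesis
      by (simp add: q_def mult.commute add.commute)
  qed
  have anti: "q (i + l) \<le> q l" for l
    using lift_Suc_antimono_le[of q l "i + l"] step by simp
  define b where "b k = c k / fact k" for k
  have b_pos: "0 < b k" for k by (simp add: b_def pos)
  have b_Suc: "b (Suc k) = b k * q k" for k
  proof -
    have "s / u * (t / (n * s)) = t / (n * u)" if "0 < s" for s t u n :: real
      using that by simp
    from this[OF pos[of k]] show ?thesis by (simp add: b_def q_def)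
  qed
  have "b (i + j) \<le> b i * b j"
  proof (induction j)
    case 0
    then show ?case by (simp add: b_def c0)
  next
    case (Suc j)
    have "b (i + Suc j) = b (i + j) * q (i + j)" by (simp add: b_Suc)
    also have "\<dots> \<le> (b i * b j) * q j"
      using Suc.IH anti[of j] b_pos[of i] b_pos[of j] b_pos[of "i+j"] q_pos[of "i + j"]
      by (intro mult_mono) (auto intro: less_imp_le)
    finally show ?case by (simp add: b_Suc)
  qed
  then have "fact (i + j) * b (i + j) \<le> fact (i + j) * (b i * b j)"
    by (intro mult_left_mono) auto
  moreover have "real ((i + j) choose i) = fact (i + j) / (fact i * fact j)"
    using binomial_fact[of i "i + j", where 'a = real] by simp
  ultimately show ?thesis by (simp add: b_def mult_ac)
qed

text \<open>
  This is the Cauchy--Schwarz inequality with weights \<open>t i = c i * c (k - i) / (x ^ i * y ^ (k - i))\<close>.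
  The hypothesis on \<open>c\<close> is what makes \<open>\<Sum>i\<le>k. 1 / t i\<close> at most
  \<open>(\<Sum>i\<le>k. (k choose i) * x ^ i * y ^ (k - i)) / c k\<close>, which the binomial theorem evaluates.
  Summing over \<open>k\<close> bounds the norm of a product of power series, with parameter \<open>x + y\<close>, by the
  product of the norms with parameters \<open>x\<close> and \<open>y\<close>.
\<close>

lemma weighted_convolution_bound:
  fixes c :: "nat \<Rightarrow> real" and a b :: "nat \<Rightarrow> complex"
  assumes pos: "\<And>k. 0 < c k"
    and sup: "\<And>i j. c (i + j) \<le> real ((i + j) choose i) * c i * c j"
    and xy: "0 < x" "0 < y"
  shows "c k * (cmod (\<Sum>i\<le>k. a i * b (k - i)))\<^sup>2 / (x + y) ^ k
    \<le> (\<Sum>i\<le>k. (c i * (cmod (a i))\<^sup>2 / x ^ i) * (c (k - i) * (cmod (b (k - i)))\<^sup>2 / y ^ (k - i)))"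
    (is "_ \<le> ?R")
proof -
  define t where "t i = c i * c (k - i) / (x ^ i * y ^ (k - i))" for i
  have t_pos: "0 < t i" for i by (simp add: t_def pos xy)
  have weights: "(\<Sum>i\<le>k. 1 / t i) \<le> (x + y) ^ k / c k"
  proof -
    have "1 / t i \<le> real (k choose i) * x ^ i * y ^ (k - i) / c k" if "i \<le> k" for i
    proof -
      have "c k \<le> real (k choose i) * c i * c (k - i)"
        using sup[of i "k - i"] that by simp
      then have "x ^ i * y ^ (k - i) * c k
          \<le> x ^ i * y ^ (k - i) * (real (k choose i) * c i * c (k - i))"
        using xy by (intro mult_left_mono) auto
      then show ?thesis
        using pos[of i] pos[of "k - i"] pos[of k] xy by (simp add: t_def field_simps)
    qed
    then have "(\<Sum>i\<le>k. 1 / t i) \<le> (\<Sum>i\<le>k. real (k choose i) * x ^ i * y ^ (k - i) / c k)"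
      by (intro sum_mono) auto
    also have "\<dots> = (x + y) ^ k / c k"
      by (simp add: binomial_ring sum_divide_distrib)
    finally show ?thesis .
  qed
  have R_eq: "?R = (\<Sum>i\<le>k. (sqrt (t i) * (cmod (a i) * cmod (b (k - i))))\<^sup>2)"
    by (intro sum.cong refl)
      (use t_pos in \<open>simp add: power_mult_distrib less_imp_le\<close>, simp add: t_def field_simps)
  have "cmod (\<Sum>i\<le>k. a i * b (k - i)) \<le> (\<Sum>i\<le>k. cmod (a i) * cmod (b (k - i)))"
    by (rule order.trans[OF norm_sum]) (simp add: norm_mult)
  also have "\<dots> = (\<Sum>i\<le>k. (sqrt (t i) * (cmod (a i) * cmod (b (k - i)))) * (1 / sqrt (t i)))"
    using t_pos by (intro sum.cong refl) (simp add: less_imp_neq[symmetric])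
  finally have "(cmod (\<Sum>i\<le>k. a i * b (k - i)))\<^sup>2
      \<le> (\<Sum>i\<le>k. (sqrt (t i) * (cmod (a i) * cmod (b (k - i)))) * (1 / sqrt (t i)))\<^sup>2"
    by (rule power_mono) simp
  also have "\<dots> \<le> ?R * (\<Sum>i\<le>k. (1 / sqrt (t i))\<^sup>2)"
    unfolding R_eq by (rule Cauchy_Schwarz_ineq_sum)
  also have "(\<Sum>i\<le>k. (1 / sqrt (t i))\<^sup>2) = (\<Sum>i\<le>k. 1 / t i)"
    using t_pos by (simp add: power_divide less_imp_le)
  also have "?R * \<dots> \<le> ?R * ((x + y) ^ k / c k)"
    by (intro mult_left_mono weights) (unfold R_eq, intro sum_nonneg zero_le_power2)
  finally show ?thesis
    using pos[of k] xy by (simp add: field_simps)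
qed

text \<open>
  Each factor \<open>F\<close> contributes \<open>1\<close> to the parameter of the weighted norm, so the \<open>n\<close>-th power
  carries the parameter \<open>n\<close>: this is the origin of the critical radius \<open>1 / sqrt n\<close>.
\<close>

lemma weighted_power_coefficient_bound:
  fixes c :: "nat \<Rightarrow> real" and F :: "complex fps"
  assumes pos: "\<And>k. 0 < c k"
    and sup: "\<And>i j. c (i + j) \<le> real ((i + j) choose i) * c i * c j"
    and summ: "summable (\<lambda>k. c k * (cmod (fps_nth F k))\<^sup>2)"
    and n: "n \<ge> 1"
  shows "summable (\<lambda>k. c k * (cmod (fps_nth (F ^ n) k))\<^sup>2 / real n ^ k) \<and>
    (\<Sum>k. c k * (cmod (fps_nth (F ^ n) k))\<^sup>2 / real n ^ k)
      \<le> (\<Sum>k. c k * (cmod (fps_nth F k))\<^sup>2) ^ n"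
  using n
proof (induction n rule: dec_induct)
  case base
  then show ?case using summ by simp
next
  case (step n)
  define u where "u k = c k * (cmod (fps_nth (F ^ n) k))\<^sup>2 / real n ^ k" for k
  define v where "v k = c k * (cmod (fps_nth F k))\<^sup>2 / 1 ^ k" for k
  define p where "p k = c k * (cmod (fps_nth (F ^ Suc n) k))\<^sup>2 / real (Suc n) ^ k" for k
  have nonneg: "0 \<le> u k" "0 \<le> v k" "0 \<le> p k" for k
    by (simp_all add: u_def v_def p_def less_imp_le[OF pos])
  have su: "summable u" and su_le: "suminf u \<le> (\<Sum>k. c k * (cmod (fps_nth F k))\<^sup>2) ^ n"
    using step.IH unfolding u_def by blast+
  have sv: "summable v" and v_eq: "suminf v = (\<Sum>k. c k * (cmod (fps_nth F k))\<^sup>2)"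
    using summ unfolding v_def by simp_all
  have le: "p k \<le> (\<Sum>i\<le>k. u i * v (k - i))" for k
    using weighted_convolution_bound[OF pos sup, of "real n" 1 k "fps_nth (F ^ n)" "fps_nth F"]
      step.hyps
    by (simp add: p_def u_def v_def fps_mult_nth atLeast0AtMost power_Suc2 add.commute
        del: power_Suc)
  have cp: "(\<lambda>k. \<Sum>i\<le>k. u i * v (k - i)) sums (suminf u * suminf v)"
    using su sv nonneg by (intro Cauchy_product_sums) simp_all
  have sp: "summable p"
    by (rule summable_comparison_test'[OF sums_summable[OF cp], of 0]) (use nonneg le in simp)
  have "suminf p \<le> suminf u * suminf v"
    using suminf_le[OF le sp sums_summable[OF cp]] sums_unique[OF cp] by simp
  also have "\<dots> \<le> (\<Sum>k. c k * (cmod (fps_nth F k))\<^sup>2) ^ n * (\<Sum>k. c k * (cmod (fps_nth F k))\<^sup>2)"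
    unfolding v_eq[symmetric] using su_le suminf_nonneg[OF sv nonneg(2)]
    by (intro mult_right_mono) (simp_all add: v_eq)
  finally show ?case
    using sp unfolding p_def by (simp add: mult.commute)
qed

lemma fps_power_nth_0_1:
  fixes F :: "'a::comm_semiring_1 fps"
  assumes "fps_nth F 0 = 1"
  shows "fps_nth (F ^ n) 0 = 1" "fps_nth (F ^ n) (Suc 0) = of_nat n * fps_nth F (Suc 0)"
proof -
  show *: "fps_nth (F ^ n) 0 = 1" for n
    by (induction n) (simp_all add: assms)
  show "fps_nth (F ^ n) (Suc 0) = of_nat n * fps_nth F (Suc 0)"
    by (induction n) (simp_all add: assms * fps_mult_nth algebra_simps)
qed

section \<open>Parseval's identity for rotation-invariant measures\<close>

text \<open>
  A rotation by the angle \<open>pi / (j - k)\<close> changes the sign of the integrand.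
\<close>

lemma rotation_invariant_integral_orthogonal:
  fixes M :: "complex measure"
  assumes sets: "sets M = sets borel"
    and rot: "\<And>\<omega>. cmod \<omega> = 1 \<Longrightarrow> distr M borel ((*) \<omega>) = M"
    and "j \<noteq> k"
  shows "(LINT z|M. z ^ j * cnj z ^ k) = 0"
proof -
  note [measurable_cong] = sets
  have [measurable]: "cnj \<in> borel_measurable borel"
    by (intro borel_measurable_continuous_onI continuous_intros)
  define t where "t = pi / (real j - real k)"
  have "cis t ^ j * cnj (cis t) ^ k = cis (real j * t) * cis (- (real k * t))"
    by (simp add: Complex.DeMoivre cis_cnj)
  also have "\<dots> = cis ((real j - real k) * t)"
    by (simp add: cis_mult algebra_simps)
  also have "\<dots> = -1" using \<open>j \<noteq> k\<close> by (simp add: t_def)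
  finally have minus: "cis t ^ j * cnj (cis t) ^ k = -1" .
  have "(LINT z|M. z ^ j * cnj z ^ k) = (LINT z|distr M borel ((*) (cis t)). z ^ j * cnj z ^ k)"
    by (simp add: rot)
  also have "\<dots> = (LINT z|M. (cis t * z) ^ j * cnj (cis t * z) ^ k)"
    by (rule integral_distr) measurable
  also have "\<dots> = (LINT z|M. (cis t ^ j * cnj (cis t) ^ k) * (z ^ j * cnj z ^ k))"
    by (intro Bochner_Integration.integral_cong refl) (simp add: power_mult_distrib)
  also have "\<dots> = - (LINT z|M. z ^ j * cnj z ^ k)"
    unfolding minus by simp
  finally show ?thesis by simp
qed

text \<open>
  On \<open>cmod z \<le> s\<close> the terms of the series are dominated by a summable sequence, so sums and
  integrals commute. Expanding only one factor at a time needs no double series: first the integral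
  of \<open>F z * cnj z ^ j\<close> is found from orthogonality, and then \<open>F z * cnj (F z)\<close> is integrated by
  expanding the conjugate factor alone.
\<close>

lemma parseval_rotation_invariant_on_smaller_disc:
  fixes M :: "complex measure" and a :: "nat \<Rightarrow> complex"
  assumes fin: "finite_measure M" and sets: "sets M = sets borel"
    and rot: "\<And>\<omega>. cmod \<omega> = 1 \<Longrightarrow> distr M borel ((*) \<omega>) = M"
    and disc: "AE z in M. cmod z \<le> s" and s: "0 \<le> s"
    and summ: "summable (\<lambda>k. cmod (a k) * s ^ k)"
    and f: "\<And>z. cmod z \<le> s \<Longrightarrow> (\<lambda>k. a k * z ^ k) sums f z"
  shows "(\<integral>\<^sup>+z. ennreal ((cmod (f z))\<^sup>2) \<partial>M)
    = (\<Sum>k. ennreal ((cmod (a k))\<^sup>2) * (\<integral>\<^sup>+z. ennreal (cmod z ^ (2 * k)) \<partial>M))"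
proof -
  interpret finite_measure M by fact
  note [measurable_cong] = sets
  have [measurable]: "cnj \<in> borel_measurable borel"
    by (intro borel_measurable_continuous_onI continuous_intros)
  define F where "F z = (\<Sum>k. a k * z ^ k)" for z
  have F_meas [measurable]: "F \<in> borel_measurable M"
    unfolding F_def by (intro borel_measurable_suminf) measurable
  have fF: "AE z in M. f z = F z"
    using disc by eventually_elim (use f in \<open>auto simp: F_def sums_iff\<close>)
  define B where "B = (\<Sum>k. cmod (a k) * s ^ k)"
  have term_le: "norm (a k * z ^ k) \<le> cmod (a k) * s ^ k" if "cmod z \<le> s" for k z
    using that by (auto simp: norm_mult norm_power intro!: mult_left_mono power_mono)
  have term_summ: "summable (\<lambda>k. norm (a k * z ^ k))" if "cmod z \<le> s" for z
    using that by (intro summable_comparison_test'[OF summ, of 0]) (use term_le in auto)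
  have F_le: "AE z in M. cmod (F z) \<le> B"
    using disc
  proof eventually_elim
    case (elim z)
    have "cmod (F z) \<le> (\<Sum>k. norm (a k * z ^ k))"
      unfolding F_def by (rule summable_norm[OF term_summ[OF elim]])
    also have "\<dots> \<le> B"
      unfolding B_def by (intro suminf_le term_le elim summ term_summ)
    finally show ?case .
  qed
  have B_nonneg: "0 \<le> B" unfolding B_def by (intro suminf_nonneg summ) (simp add: s)
  define m where "m k = (LINT z|M. cmod z ^ (2 * k))" for k
  have int_pow: "integrable M (\<lambda>z. cmod z ^ k)" for k
    by (rule integrable_const_bound[where B = "s ^ k"])
      (use disc in \<open>eventually_elim, auto intro!: power_mono\<close>, measurable)
  have mom: "(LINT z|M. z ^ k * cnj z ^ j) = (if k = j then complex_of_real (m j) else 0)" for j k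
  proof (cases "k = j")
    case True
    have "(LINT z|M. z ^ k * cnj z ^ j) = (LINT z|M. complex_of_real (cmod z ^ (2 * j)))"
      using True
      by (intro Bochner_Integration.integral_cong refl)
        (simp add: power_mult power_mult_distrib[symmetric] complex_norm_square del: of_real_power,
         simp add: complex_norm_square[symmetric])
    then show ?thesis using True by (simp add: m_def del: of_real_power)
  next
    case False
    then show ?thesis using rotation_invariant_integral_orthogonal[OF sets rot] by simp
  qed
  have bound_int: "norm (LINT z|M. norm (h z)) \<le> C * measure M (space M)"
    if "AE z in M. norm (h z) \<le> C" "h \<in> borel_measurable M" for h :: "complex \<Rightarrow> complex" and C
  proof -
    have "integrable M h" using that by (intro integrable_const_bound)
    then have "(LINT z|M. norm (h z)) \<le> (LINT z|M. C)"
      using that by (intro integral_mono_AE) auto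
    then show ?thesis by (simp add: mult.commute)
  qed
  have coeff: "(LINT z|M. F z * cnj z ^ j) = a j * m j" for j
  proof -
    have le: "AE z in M. norm (a k * z ^ k * cnj z ^ j) \<le> cmod (a k) * s ^ k * s ^ j" for k
      using disc
    proof eventually_elim
      case (elim z)
      then show ?case
        using mult_mono[OF term_le[OF elim, of k] power_mono[OF elim, of j]] s
        by (simp add: norm_mult norm_power)
    qed
    have 1: "AE z in M. summable (\<lambda>k. norm (a k * z ^ k * cnj z ^ j))"
      using disc by eventually_elim (auto simp: norm_mult[of _ "cnj _ ^ _"] intro!: summable_mult2 term_summ)
    have 2: "summable (\<lambda>k. LINT z|M. norm (a k * z ^ k * cnj z ^ j))"
    proof (rule summable_comparison_test'[of _ 0])
      show "summable (\<lambda>k. cmod (a k) * s ^ k * s ^ j * measure M (space M))"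
        by (intro summable_mult2 summ)
    qed (rule bound_int[OF le], measurable)
    have 3: "integrable M (\<lambda>z. a k * z ^ k * cnj z ^ j)" for k
      by (rule integrable_const_bound[OF le]) measurable
    have "(LINT z|M. F z * cnj z ^ j) = (LINT z|M. (\<Sum>k. a k * z ^ k * cnj z ^ j))"
      using disc
      by (intro integral_cong_AE, measurable, (eventually_elim,
          simp add: F_def suminf_mult2[OF summable_norm_cancel[OF term_summ]]))
    also have "\<dots> = (\<Sum>k. LINT z|M. a k * z ^ k * cnj z ^ j)"
      by (rule integral_suminf[OF 3 1 2])
    also have "\<dots> = (\<Sum>k. if k = j then a j * m j else 0)"
      by (intro suminf_cong) (simp add: mult.assoc mom)
    also have "\<dots> = a j * m j"
      using sums_single[of j "\<lambda>k. a j * m j"] by (simp add: sums_iff)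
    finally show ?thesis .
  qed
  have le: "AE z in M. norm (F z * cnj (a k * z ^ k)) \<le> B * (cmod (a k) * s ^ k)" for k
    using disc F_le
  proof eventually_elim
    case (elim z)
    then show ?case
      using mult_mono[OF elim(2) term_le[OF elim(1), of k]] B_nonneg
      by (simp add: norm_mult norm_power)
  qed
  have 1: "AE z in M. summable (\<lambda>k. norm (F z * cnj (a k * z ^ k)))"
    using disc by eventually_elim
      (unfold norm_mult[of "F _"] complex_mod_cnj, intro summable_mult term_summ)
  have 2: "summable (\<lambda>k. LINT z|M. norm (F z * cnj (a k * z ^ k)))"
  proof (rule summable_comparison_test'[of _ 0])
    show "summable (\<lambda>k. B * (cmod (a k) * s ^ k) * measure M (space M))"
      by (intro summable_mult2 summable_mult summ)
  qed (rule bound_int[OF le], measurable)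
  have 3: "integrable M (\<lambda>z. F z * cnj (a k * z ^ k))" for k
    by (rule integrable_const_bound[OF le]) measurable
  have each: "(LINT z|M. F z * cnj (a k * z ^ k)) = complex_of_real ((cmod (a k))\<^sup>2 * m k)" for k
  proof -
    have "(LINT z|M. F z * cnj (a k * z ^ k)) = (LINT z|M. cnj (a k) * (F z * cnj z ^ k))"
      by (intro Bochner_Integration.integral_cong refl) (simp add: mult_ac)
    also have "\<dots> = cnj (a k) * (a k * m k)"
      by (simp add: coeff)
    also have "\<dots> = complex_of_real ((cmod (a k))\<^sup>2 * m k)"
      by (simp add: complex_norm_square mult_ac del: of_real_power)
    finally show ?thesis .
  qed
  have total: "(LINT z|M. complex_of_real ((cmod (F z))\<^sup>2)) = (LINT z|M. (\<Sum>k. F z * cnj (a k * z ^ k)))"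
  proof (rule integral_cong_AE)
    show "AE z in M. complex_of_real ((cmod (F z))\<^sup>2) = (\<Sum>k. F z * cnj (a k * z ^ k))"
      using disc
    proof eventually_elim
      case (elim z)
      have "(\<lambda>k. a k * z ^ k) sums F z"
        using summable_norm_cancel[OF term_summ[OF elim]] by (simp add: F_def summable_sums)
      then have "(\<lambda>k. F z * cnj (a k * z ^ k)) sums (F z * cnj (F z))"
        by (intro sums_mult) (simp only: sums_cnj)
      then show ?case by (simp add: sums_iff complex_norm_square del: of_real_power)
    qed
  qed measurable
  have "(\<lambda>k. complex_of_real ((cmod (a k))\<^sup>2 * m k)) sums complex_of_real (LINT z|M. (cmod (F z))\<^sup>2)"
    using sums_integral[OF 3 1 2] each total by (simp del: of_real_power of_real_mult)
  then have S: "(\<lambda>k. (cmod (a k))\<^sup>2 * m k) sums (LINT z|M. (cmod (F z))\<^sup>2)"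
    by (simp only: sums_of_real_iff)
  have "(\<integral>\<^sup>+z. ennreal ((cmod (f z))\<^sup>2) \<partial>M) = (\<integral>\<^sup>+z. ennreal ((cmod (F z))\<^sup>2) \<partial>M)"
    by (intro nn_integral_cong_AE) (use fF in eventually_elim, simp)
  also have "\<dots> = ennreal (LINT z|M. (cmod (F z))\<^sup>2)"
  proof (rule nn_integral_eq_integral)
    show "integrable M (\<lambda>z. (cmod (F z))\<^sup>2)"
      by (rule integrable_const_bound[where B = "B\<^sup>2"])
        (use F_le in \<open>eventually_elim, auto intro!: power_mono\<close>, measurable)
  qed simp
  also have "\<dots> = (\<Sum>k. ennreal ((cmod (a k))\<^sup>2 * m k))"
    using S by (subst suminf_ennreal2) (auto simp: sums_iff m_def)
  also have "\<dots> = (\<Sum>k. ennreal ((cmod (a k))\<^sup>2) * (\<integral>\<^sup>+z. ennreal (cmod z ^ (2 * k)) \<partial>M))"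
    by (intro suminf_cong)
      (subst nn_integral_eq_integral[OF int_pow], simp_all add: m_def ennreal_mult')
  finally show ?thesis .
qed

text \<open>
  Near the unit circle the series need not converge uniformly and the integral may be infinite.
  Restricting \<open>M\<close> to a smaller concentric disc keeps it rotation-invariant, and both sides increase
  to their values for \<open>M\<close> as the discs exhaust the unit disc.
\<close>

theorem parseval_rotation_invariant:
  fixes M :: "complex measure" and a :: "nat \<Rightarrow> complex"
  assumes fin: "finite_measure M" and sets: "sets M = sets borel"
    and rot: "\<And>\<omega>. cmod \<omega> = 1 \<Longrightarrow> distr M borel ((*) \<omega>) = M"
    and disc: "AE z in M. cmod z < 1"
    and f: "\<And>z. cmod z < 1 \<Longrightarrow> (\<lambda>k. a k * z ^ k) sums f z"
  shows "(\<integral>\<^sup>+z. ennreal ((cmod (f z))\<^sup>2) \<partial>M)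
    = (\<Sum>k. ennreal ((cmod (a k))\<^sup>2) * (\<integral>\<^sup>+z. ennreal (cmod z ^ (2 * k)) \<partial>M))"
proof -
  interpret finite_measure M by fact
  note [measurable_cong] = sets
  have [measurable]: "cnj \<in> borel_measurable borel"
    by (intro borel_measurable_continuous_onI continuous_intros)
  define s where "s i = 1 - 1 / (real i + 1)" for i
  define D where "D i = cball (0::complex) (s i)" for i
  have D_meas [measurable]: "D i \<in> sets borel" for i by (simp add: D_def)
  have s: "0 \<le> s i" "s i < 1" for i by (simp_all add: s_def)
  have s_mono: "s i \<le> s j" if "i \<le> j" for i j
    using that by (simp add: s_def frac_le)
  have D_mono: "indicator (D i) z \<le> (indicator (D j) z :: ennreal)" if "i \<le> j" for i j z
    using s_mono[OF that] by (auto simp: D_def indicator_def)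
  have s_ex: "\<exists>i. r \<le> s i" if r: "r < 1" for r
  proof -
    obtain i where "inverse (real (Suc i)) < 1 - r"
      using reals_Archimedean[of "1 - r"] r by auto
    then have "r \<le> s i" by (simp add: s_def inverse_eq_divide add.commute)
    then show ?thesis ..
  qed
  define N where "N i = density M (indicator (D i))" for i
  have N_sets: "sets (N i) = sets borel" for i by (simp add: N_def sets)
  have N_int: "(\<integral>\<^sup>+z. h z \<partial>N i) = (\<integral>\<^sup>+z. h z * indicator (D i) z \<partial>M)"
    if [measurable]: "h \<in> borel_measurable borel" for h i
    unfolding N_def by (subst nn_integral_density) (measurable, simp add: mult.commute)
  define F where "F z = (\<Sum>k. a k * z ^ k)" for z
  have F_meas [measurable]: "F \<in> borel_measurable borel"
    unfolding F_def by (intro borel_measurable_suminf) measurable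
  have F: "(\<lambda>k. a k * z ^ k) sums F z" if "cmod z < 1" for z
    using f[OF that] by (simp add: F_def sums_iff)
  \<comment> \<open>On the support of \<open>N i\<close> the series converges uniformly, as \<open>s i < 1\<close>.\<close>
  have part: "(\<integral>\<^sup>+z. ennreal ((cmod (F z))\<^sup>2) * indicator (D i) z \<partial>M)
    = (\<Sum>k. ennreal ((cmod (a k))\<^sup>2) * (\<integral>\<^sup>+z. ennreal (cmod z ^ (2 * k)) * indicator (D i) z \<partial>M))" for i
  proof -
    have "(\<integral>\<^sup>+z. ennreal ((cmod (F z))\<^sup>2) \<partial>N i)
        = (\<Sum>k. ennreal ((cmod (a k))\<^sup>2) * (\<integral>\<^sup>+z. ennreal (cmod z ^ (2 * k)) \<partial>N i))"
    proof (rule parseval_rotation_invariant_on_smaller_disc)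
      show "finite_measure (N i)"
      proof
        have "emeasure (N i) (space (N i)) \<le> emeasure M (space M)"
          unfolding N_def using emeasure_mono[of "D i" "space M" M]
          by (subst emeasure_density) (auto simp: sets_eq_imp_space_eq[OF sets])
        then show "emeasure (N i) (space (N i)) \<noteq> \<infinity>"
          using emeasure_finite[of "space M"] by (auto simp: top_unique)
      qed
      show "sets (N i) = sets borel" by (rule N_sets)
      show "distr (N i) borel ((*) \<omega>) = N i" if "cmod \<omega> = 1" for \<omega>
      proof (rule measure_eqI)
        fix A assume "A \<in> sets (distr (N i) borel ((*) \<omega>))"
        then have A [measurable]: "A \<in> sets borel" by simp
        have "emeasure (distr (N i) borel ((*) \<omega>)) A = (\<integral>\<^sup>+z. indicator A z \<partial>distr (N i) borel ((*) \<omega>))"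
          by simp
        also have "\<dots> = (\<integral>\<^sup>+z. indicator A (\<omega> * z) \<partial>N i)"
          by (subst nn_integral_distr) (auto simp: N_def)
        also have "\<dots> = (\<integral>\<^sup>+z. indicator A (\<omega> * z) * indicator (D i) z \<partial>M)"
          by (rule N_int) measurable
        also have "\<dots> = (\<integral>\<^sup>+z. indicator A (\<omega> * z) * indicator (D i) (\<omega> * z) \<partial>M)"
          using that by (simp add: D_def indicator_def norm_mult)
        also have "\<dots> = (\<integral>\<^sup>+z. indicator A z * indicator (D i) z \<partial>distr M borel ((*) \<omega>))"
          by (subst nn_integral_distr) measurable
        also have "\<dots> = emeasure (N i) A"
          by (subst rot[OF that], subst N_int[symmetric]) (auto simp: N_sets)
        finally show "emeasure (distr (N i) borel ((*) \<omega>)) A = emeasure (N i) A" .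
      qed (simp add: N_sets)
      show "AE z in N i. cmod z \<le> s i"
        unfolding N_def by (subst AE_density, measurable) (auto simp: D_def indicator_def)
      show "summable (\<lambda>k. cmod (a k) * s i ^ k)"
      proof -
        obtain r where r: "s i < r" "r < 1" using dense[OF s(2)] by blast
        have "summable (\<lambda>k. a k * complex_of_real r ^ k)"
          using F[of "complex_of_real r"] r s(1)[of i] by (auto simp: sums_iff)
        then have "summable (\<lambda>k. norm (a k * complex_of_real (s i) ^ k))"
          using r s(1)[of i] by (intro powser_insidea) auto
        then show ?thesis using s(1)[of i] by (simp add: norm_mult norm_power)
      qed
    qed (use F s[of i] in auto)
    then show ?thesis by (simp add: N_int)
  qed
  \<comment> \<open>Both sides increase to their values on the whole disc.\<close>
  have lim: "(\<integral>\<^sup>+z. h z \<partial>M) = (SUP i. \<integral>\<^sup>+z. h z * indicator (D i) z \<partial>M)"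
    if [measurable]: "h \<in> borel_measurable borel" for h :: "complex \<Rightarrow> ennreal"
  proof -
    have "(\<integral>\<^sup>+z. h z \<partial>M) = (\<integral>\<^sup>+z. (SUP i. h z * indicator (D i) z) \<partial>M)"
    proof (rule nn_integral_cong_AE, use disc in eventually_elim)
      case (elim z)
      obtain i where "cmod z \<le> s i" using s_ex[OF elim] by blast
      then have "h z * indicator (D i) z = h z" by (simp add: D_def)
      then show ?case
        by (intro antisym) (auto intro!: SUP_upper2[of i] SUP_least simp: indicator_def)
    qed
    also have "\<dots> = (SUP i. \<integral>\<^sup>+z. h z * indicator (D i) z \<partial>M)"
      by (rule nn_integral_monotone_convergence_SUP)
        (auto simp: incseq_def le_fun_def intro!: mult_left_mono D_mono)
    finally show ?thesis .
  qed
  have "(\<integral>\<^sup>+z. ennreal ((cmod (f z))\<^sup>2) \<partial>M) = (\<integral>\<^sup>+z. ennreal ((cmod (F z))\<^sup>2) \<partial>M)"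
    using disc by (intro nn_integral_cong_AE, eventually_elim)
      (use f in \<open>simp add: F_def sums_iff\<close>)
  also have "\<dots> = (SUP i. \<Sum>k. ennreal ((cmod (a k))\<^sup>2) * (\<integral>\<^sup>+z. ennreal (cmod z ^ (2 * k)) * indicator (D i) z \<partial>M))"
    by (subst lim) (measurable, simp add: part)
  also have "\<dots> = (\<Sum>k. SUP i. ennreal ((cmod (a k))\<^sup>2) * (\<integral>\<^sup>+z. ennreal (cmod z ^ (2 * k)) * indicator (D i) z \<partial>M))"
    by (rule ennreal_suminf_SUP_eq[symmetric])
      (auto simp: incseq_def intro!: mult_left_mono nn_integral_mono D_mono)
  also have "\<dots> = (\<Sum>k. ennreal ((cmod (a k))\<^sup>2) * (\<integral>\<^sup>+z. ennreal (cmod z ^ (2 * k)) \<partial>M))"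
    by (subst (2) lim) (measurable, simp add: SUP_mult_left_ennreal)
  finally show ?thesis .
qed

section \<open>Radial weights as measures on the disc\<close>

lemma borel_measurable_Complex_vec2 [measurable]:
  "(\<lambda>x::real^2. Complex (x $ 1) (x $ 2)) \<in> borel_measurable borel"
  by (intro borel_measurable_continuous_onI) (simp add: Complex_eq continuous_intros)

text \<open>
  Orthogonal invariance of Lebesgue measure is a theorem about \<open>real ^ 'n\<close>. This identification
  carries it over to the complex plane.
\<close>

lemma lborel_complex_eq_distr_vec2:
  "(lborel :: complex measure) = distr lborel borel (\<lambda>x::real^2. Complex (x $ 1) (x $ 2))"
proof (rule lborel_eqI)
  fix l u :: complex
  assume le: "\<And>b. b \<in> Basis \<Longrightarrow> l \<bullet> b \<le> u \<bullet> b"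
  define l' u' :: "real^2" where "l' = vector [Re l, Im l]" and "u' = vector [Re u, Im u]"
  have eq: "(\<lambda>x::real^2. Complex (x $ 1) (x $ 2)) -` box l u = box l' u'"
    by (auto simp: l'_def u'_def mem_box_cart in_box_complex_iff forall_2)
  have B: "(Basis :: (real^2) set) = {axis 1 1, axis 2 1}"
    by (auto simp: Basis_vec_def UNIV_2)
  have le': "l' \<bullet> b \<le> u' \<bullet> b" if "b \<in> Basis" for b
    using that le[of 1] le[of \<i>]
    by (auto simp: B l'_def u'_def inner_axis Basis_complex_def)
  have "emeasure (distr lborel borel (\<lambda>x::real^2. Complex (x $ 1) (x $ 2))) (box l u)
      = emeasure lborel (box l' u')"
    by (subst emeasure_distr) (auto simp: eq)
  also have "\<dots> = (\<Prod>b\<in>Basis. (u' - l') \<bullet> b)"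
    by (rule emeasure_lborel_box[OF le'])
  also have "(\<Prod>b\<in>Basis. (u' - l') \<bullet> b) = (\<Prod>b\<in>Basis. (u - l) \<bullet> b)"
  proof -
    have "axis 1 (1::real) \<noteq> (axis 2 1 :: real^2)" by (simp add: axis_eq_axis)
    then show ?thesis
      by (simp add: B Basis_complex_def inner_axis l'_def u'_def)
  qed
  finally show "emeasure (distr lborel borel (\<lambda>x::real^2. Complex (x $ 1) (x $ 2))) (box l u)
      = (\<Prod>b\<in>Basis. (u - l) \<bullet> b)" .
qed simp

text \<open>
  In the coordinates \<open>\<phi>\<close>, the rotated preimage of a box is the image of a box under the orthogonal
  map \<open>T\<close>, so it has the same measure.
\<close>

lemma distr_lborel_mult_unimodular:
  assumes \<omega>: "cmod \<omega> = 1"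
  shows "distr lborel borel ((*) \<omega>) = (lborel :: complex measure)"
proof (rule lborel_eqI[symmetric])
  fix l u :: complex
  assume le: "\<And>b. b \<in> Basis \<Longrightarrow> l \<bullet> b \<le> u \<bullet> b"
  define \<phi> :: "real^2 \<Rightarrow> complex" where "\<phi> x = Complex (x $ 1) (x $ 2)" for x
  define \<psi> :: "complex \<Rightarrow> real^2" where "\<psi> z = vector [Re z, Im z]" for z
  define T where "T x = \<psi> (cnj \<omega> * \<phi> x)" for x
  have \<phi>\<psi> [simp]: "\<phi> (\<psi> z) = z" for z by (simp add: \<phi>_def \<psi>_def)
  have \<psi>\<phi> [simp]: "\<psi> (\<phi> x) = x" for x
    by (simp add: \<phi>_def \<psi>_def vec_eq_iff forall_2)
  have \<omega>\<omega> [simp]: "\<omega> * cnj \<omega> = 1" "cnj \<omega> * \<omega> = 1"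
    using complex_norm_square[of \<omega>] \<omega> by (simp_all add: mult.commute)
  have norm\<phi>: "cmod (\<phi> x) = norm x" for x
    by (simp add: \<phi>_def norm_vec_def L2_set_def sum_2 cmod_def)
  have norm\<psi>: "norm (\<psi> z) = cmod z" for z
    using norm\<phi>[of "\<psi> z"] by simp
  have "orthogonal_transformation T"
    unfolding orthogonal_transformation
  proof
    show "linear T"
      by (rule linearI)
        (simp_all add: T_def \<psi>_def \<phi>_def vec_eq_iff forall_2 algebra_simps)
    show "\<forall>v. norm (T v) = norm v"
      by (simp add: T_def norm\<psi> norm_mult \<omega> norm\<phi>)
  qed
  note T = measurable_orthogonal_image[OF this] measure_orthogonal_image[OF this]
  have \<phi>_meas [measurable]: "\<phi> \<in> borel_measurable borel"
    unfolding \<phi>_def by measurable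
  have lb: "(lborel :: complex measure) = distr lborel borel \<phi>"
    unfolding \<phi>_def by (rule lborel_complex_eq_distr_vec2)
  define P where "P = \<phi> -` box l u"
  have P_meas: "P \<in> sets borel"
    using measurable_sets[OF \<phi>_meas, of "box l u"] by (simp add: P_def)
  have P_em: "emeasure lborel P = emeasure lborel (box l u)"
    by (subst lb, subst emeasure_distr) (auto simp: P_def)
  then have P_fin: "emeasure lborel P < \<infinity>"
    using emeasure_lborel_box_finite[of l u] by simp
  have P_lm: "P \<in> lmeasurable"
    using P_meas P_fin by (intro fmeasurableI) auto
  have TP: "T ` P = \<phi> -` ((*) \<omega> -` box l u)"
  proof (intro equalityI subsetI)
    fix x assume "x \<in> T ` P"
    then show "x \<in> \<phi> -` ((*) \<omega> -` box l u)"
      by (auto simp: T_def P_def mult.assoc[symmetric])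
  next
    fix x assume x: "x \<in> \<phi> -` ((*) \<omega> -` box l u)"
    have "x = T (\<psi> (\<omega> * \<phi> x))" by (simp add: T_def mult.assoc[symmetric])
    moreover have "\<psi> (\<omega> * \<phi> x) \<in> P" using x by (simp add: P_def)
    ultimately show "x \<in> T ` P" by blast
  qed
  have meas: "(*) \<omega> -` box l u \<in> sets borel"
    using measurable_sets_borel[of "(*) \<omega>" borel "box l u"] by simp
  have TP_meas: "T ` P \<in> sets borel"
    unfolding TP using measurable_sets[OF \<phi>_meas meas] by simp
  have "emeasure (distr lborel borel ((*) \<omega>)) (box l u) = emeasure lborel ((*) \<omega> -` box l u)"
    by (subst emeasure_distr) auto
  also have "\<dots> = emeasure lborel (T ` P)"
    unfolding TP by (subst lb, subst emeasure_distr) (use meas in auto)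
  also have "\<dots> = emeasure lborel P"
  proof -
    have "emeasure lebesgue (T ` P) = emeasure lebesgue P"
      using T[OF P_lm] P_lm by (simp add: emeasure_eq_measure2)
    then show ?thesis using TP_meas P_meas by simp
  qed
  also have "\<dots> = (\<Prod>b\<in>Basis. (u - l) \<bullet> b)"
    unfolding P_em by (rule emeasure_lborel_box[OF le])
  finally show "emeasure (distr lborel borel ((*) \<omega>)) (box l u) = (\<Prod>b\<in>Basis. (u - l) \<bullet> b)" .
qed simp

lemma emeasure_unit_disc_outside:
  assumes "0 \<le> x" "x \<le> 1"
  shows "emeasure lborel ({z::complex. x < cmod z} \<inter> ball 0 1) = ennreal (pi * (1 - x\<^sup>2))"
proof -
  have "emeasure lborel ({z. x < cmod z} \<inter> ball 0 1) = emeasure lborel (ball 0 1 - ball (0::complex) 1 \<inter> cball 0 x)"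
    by (intro arg_cong[of _ _ "emeasure lborel"]) auto
  also have "\<dots> = emeasure lborel (ball (0::complex) 1) - emeasure lborel (ball (0::complex) 1 \<inter> cball 0 x)"
  proof (rule emeasure_Diff)
    show "emeasure lborel (ball (0::complex) 1 \<inter> cball 0 x) \<noteq> \<infinity>"
      using emeasure_mono[of "ball (0::complex) 1 \<inter> cball 0 x" "ball 0 1" lborel]
        emeasure_lborel_ball_finite[of "0::complex" 1] by (auto simp: top_unique)
  qed auto
  also have "emeasure lborel (ball (0::complex) 1 \<inter> cball 0 x) = ennreal (pi * x\<^sup>2)"
  proof (cases "x < 1")
    case True
    then have "ball (0::complex) 1 \<inter> cball 0 x = cball 0 x" by auto
    then show ?thesis using assms by (simp add: emeasure_cball unit_ball_vol_2)
  next
    case False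
    with assms have "x = 1" by simp
    then have "ball (0::complex) 1 \<inter> cball 0 x = ball 0 1" by auto
    then show ?thesis using \<open>x = 1\<close> by (simp add: emeasure_ball unit_ball_vol_2)
  qed
  also have "emeasure lborel (ball (0::complex) 1) = ennreal pi"
    by (simp add: emeasure_ball unit_ball_vol_2)
  also have "ennreal pi - ennreal (pi * x\<^sup>2) = ennreal (pi * (1 - x\<^sup>2))"
    by (subst ennreal_minus) (auto simp: algebra_simps)
  finally show ?thesis .
qed

lemma unit_disc_borel [measurable]: "ball (0::complex) 1 \<in> sets borel"
  by simp

text \<open>
  Polar coordinates for radial functions: both measures give \<open>{x<..}\<close> the area of the part of the
  unit disc outside the circle of radius \<open>x\<close>.
\<close>

lemma distr_cmod_unit_disc:
  "distr (density lborel (indicator (ball 0 1))) borel cmod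
    = density lborel (\<lambda>\<rho>. ennreal (2 * pi * \<rho>) * indicator {0..1} \<rho>)"
  (is "?A = ?B")
proof -
  have A: "emeasure ?A {x<..} = emeasure lborel ({z. x < cmod z} \<inter> ball 0 1)" for x
  proof -
    have [measurable]: "{z::complex. x < cmod z} \<in> sets borel"
      by (intro borel_open open_Collect_less continuous_intros)
    have "emeasure ?A {x<..} = emeasure (density lborel (indicator (ball 0 1))) {z::complex. x < cmod z}"
      by (subst emeasure_distr) (simp_all add: vimage_def)
    also have "\<dots> = (\<integral>\<^sup>+z. indicator (ball 0 1) z * indicator {z. x < cmod z} z \<partial>lborel)"
      by (rule emeasure_density) simp_all
    also have "\<dots> = (\<integral>\<^sup>+z. indicator ({z. x < cmod z} \<inter> ball 0 1) z \<partial>lborel)"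
      by (intro nn_integral_cong) (auto simp: indicator_def)
    also have "\<dots> = emeasure lborel ({z. x < cmod z} \<inter> ball 0 1)"
      by (rule nn_integral_indicator) simp
    finally show ?thesis .
  qed
  have AB: "emeasure ?A {x<..} = emeasure ?B {x<..}" for x
  proof -
    define y where "y = min 1 (max 0 x)"
    have y: "0 \<le> y" "y \<le> 1" by (auto simp: y_def)
    have "emeasure ?A {x<..} = ennreal (pi * (1 - y\<^sup>2))"
    proof (cases "x < 0")
      case True
      then have "{z. x < cmod z} \<inter> ball 0 1 = ball (0::complex) 1"
        by (auto intro: less_le_trans)
      then show ?thesis using True by (simp add: A y_def emeasure_ball unit_ball_vol_2)
    next
      case False
      then have "{z. x < cmod z} \<inter> ball 0 1 = {z. y < cmod z} \<inter> ball (0::complex) 1"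
        by (auto simp: y_def)
      then show ?thesis by (simp add: A emeasure_unit_disc_outside[OF y])
    qed
    moreover have "emeasure ?B {x<..} = ennreal (pi * (1 - y\<^sup>2))"
    proof -
      have "emeasure ?B {x<..} = (\<integral>\<^sup>+\<rho>. ennreal (2 * pi * \<rho>) * indicator {y..1} \<rho> \<partial>lborel)"
        by (subst emeasure_density, simp, simp, rule nn_integral_cong_AE)
          (use AE_lborel_singleton[of y] AE_lborel_singleton[of 1] in
            \<open>eventually_elim, auto simp: indicator_def y_def\<close>)
      also have "\<dots> = ennreal (pi * 1\<^sup>2 - pi * y\<^sup>2)"
        by (rule nn_integral_FTC_Icc) (use y in \<open>auto intro!: derivative_eq_intros\<close>)
      finally show ?thesis by (simp add: algebra_simps)
    qed
    ultimately show ?thesis by simp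
  qed
  show ?thesis
  proof (rule measure_eqI_lessThan)
    show "emeasure ?A {x<..} < \<infinity>" for x
      unfolding A using emeasure_mono[of "{z. x < cmod z} \<inter> ball 0 1" "ball (0::complex) 1" lborel]
        emeasure_lborel_ball_finite[of "0::complex" 1] by (auto intro: le_less_trans)
  qed (auto simp: AB)
qed

lemma nn_integral_radial:
  assumes [measurable]: "u \<in> borel_measurable borel"
  shows "(\<integral>\<^sup>+z. u (cmod z) * indicator (ball 0 1) z \<partial>lborel)
    = (\<integral>\<^sup>+\<rho>. u \<rho> * (ennreal (2 * pi * \<rho>) * indicator {0..1} \<rho>) \<partial>lborel)"
proof -
  have "(\<integral>\<^sup>+z. u (cmod z) * indicator (ball 0 1) z \<partial>lborel)
      = (\<integral>\<^sup>+\<rho>. u \<rho> \<partial>distr (density lborel (indicator (ball 0 1))) borel cmod)"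
    by (subst nn_integral_distr, simp, simp, subst nn_integral_density) (auto simp: mult.commute)
  also have "\<dots> = (\<integral>\<^sup>+\<rho>. u \<rho> * (ennreal (2 * pi * \<rho>) * indicator {0..1} \<rho>) \<partial>lborel)"
    unfolding distr_cmod_unit_disc by (subst nn_integral_density) (auto simp: mult.commute)
  finally show ?thesis .
qed

text \<open>
  A null set of radii sweeps out a null set of the disc. Hence a weight may be changed on a null set
  of radii, which is how Lebesgue measurable weights are reduced to Borel ones.
\<close>

lemma AE_lborel_radial:
  assumes "AE \<rho> in lborel. P \<rho>"
  shows "AE z::complex in lborel. cmod z < 1 \<longrightarrow> P (cmod z)"
proof -
  obtain N where N: "{\<rho>. \<not> P \<rho>} \<subseteq> N" "emeasure lborel N = 0" "N \<in> sets lborel"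
    using AE_E[OF assms] by auto
  have N_meas [measurable]: "N \<in> sets borel" using N by simp
  have "AE \<rho> in lborel. \<rho> \<notin> N" using N by (intro AE_not_in) (auto simp: null_sets_def)
  then have "(\<integral>\<^sup>+\<rho>. indicator N \<rho> * (ennreal (2 * pi * \<rho>) * indicator {0..1} \<rho>) \<partial>lborel) = 0"
    by (subst nn_integral_0_iff_AE) (measurable, auto simp: indicator_def)
  then have "(\<integral>\<^sup>+z. indicator N (cmod z) * indicator (ball 0 1) z \<partial>lborel) = 0"
    by (subst nn_integral_radial) measurable
  then have "AE z::complex in lborel. indicator N (cmod z) * indicator (ball 0 1) z = (0::ennreal)"
    by (subst (asm) nn_integral_0_iff_AE) measurable
  then show ?thesis
    by eventually_elim (use N(1) in \<open>auto simp: indicator_def split: if_splits\<close>)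
qed

text \<open>
  Replacing the density \<open>w (cmod z) / (2 * pi)\<close> by a Borel measure \<open>M\<close> removes the weight from all
  later arguments. The origin is excluded in \<open>punctured_disc\<close> so that a vanishing moment forces
  \<open>M = 0\<close>.
\<close>

locale bergman_measure =
  fixes w :: "real \<Rightarrow> real" and M :: "complex measure"
  assumes finite: "finite_measure M" and sets: "sets M = sets borel"
    and rotation: "\<And>\<omega>. cmod \<omega> = 1 \<Longrightarrow> distr M borel ((*) \<omega>) = M"
    and punctured_disc: "AE z in M. 0 < cmod z \<and> cmod z < 1"
    and moment: "\<And>m. (\<integral>\<^sup>+z. ennreal (cmod z ^ m) \<partial>M) = ennreal (weight_moment w m)"
    and integrable: "\<And>h::complex \<Rightarrow> real. h \<in> borel_measurable borel \<Longrightarrow>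
      set_integrable lebesgue (ball 0 1) (\<lambda>z. h z * w (cmod z)) \<longleftrightarrow> integrable M h"
    and integral: "\<And>h::complex \<Rightarrow> real. h \<in> borel_measurable borel \<Longrightarrow>
      1 / (2 * pi) * (LINT z:ball 0 1|lebesgue. h z * w (cmod z)) = (LINT z|M. h z)"

text \<open>
  The weight is only Lebesgue measurable on \<open>[0, 1)\<close>. The measure is built from a Borel function
  that agrees with it almost everywhere, so that the integrals over the disc do not change.
\<close>

theorem bergman_measure_exists:
  assumes w: "bergman_weight w"
  shows "\<exists>M. bergman_measure w M"
proof -
  define w1 where "w1 \<rho> = indicator {0..<1} \<rho> * w \<rho>" for \<rho>
  have w1_int: "integrable lebesgue w1" and w1_nonneg: "0 \<le> w1 \<rho>" for \<rho>
    using w by (auto simp: bergman_weight_def set_integrable_def w1_def[abs_def] indicator_def)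
  obtain v0 where v0 [measurable]: "v0 \<in> borel_measurable lborel" and v0_eq: "AE \<rho> in lborel. w1 \<rho> = v0 \<rho>"
    using completion_ex_borel_measurable_real[OF borel_measurable_integrable[OF w1_int]] by auto
  \<comment> \<open>A Borel version of the weight, cut off so that it vanishes outside \<open>[0, 1)\<close>.\<close>
  define v where "v \<rho> = indicator {0..<1} \<rho> * max 0 (v0 \<rho>)" for \<rho> :: real
  have v_meas [measurable]: "v \<in> borel_measurable borel"
    unfolding v_def by measurable
  have v_nonneg: "0 \<le> v \<rho>" for \<rho> by (simp add: v_def)
  have v_eq: "AE \<rho> in lborel. w1 \<rho> = v \<rho>"
    using v0_eq by eventually_elim (metis (no_types, lifting) indicator_simps max.absorb2 mult_1
        mult_zero_left v_def w1_def w1_nonneg)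
  have vz_eq: "AE z::complex in lborel. w1 (cmod z) = v (cmod z)"
    using AE_lborel_radial[OF v_eq]
    by eventually_elim (auto simp: w1_def v_def indicator_def)
  define M where "M = density lborel (\<lambda>z. ennreal (v (cmod z) / (2 * pi)))"
  have sets: "sets M = sets borel" by (simp add: M_def)
  have mom: "(\<integral>\<^sup>+z. ennreal (cmod z ^ m) \<partial>M) = ennreal (weight_moment w m)" for m
  proof -
    have "(\<integral>\<^sup>+z. ennreal (cmod z ^ m) \<partial>M)
        = (\<integral>\<^sup>+z. (ennreal (cmod z ^ m) * ennreal (v (cmod z) / (2 * pi))) * indicator (ball 0 1) z \<partial>lborel)"
      unfolding M_def by (subst nn_integral_density)
        (auto intro!: nn_integral_cong simp: v_def indicator_def mult.commute)
    also have "\<dots> = (\<integral>\<^sup>+\<rho>. (ennreal (\<rho> ^ m) * ennreal (v \<rho> / (2 * pi))) * (ennreal (2 * pi * \<rho>) * indicator {0..1} \<rho>) \<partial>lborel)"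
      by (rule nn_integral_radial) measurable
    also have "\<dots> = (\<integral>\<^sup>+\<rho>. ennreal (\<rho> ^ (m + 1) * v \<rho>) \<partial>lborel)"
      by (intro nn_integral_cong)
        (auto simp: indicator_def v_def ennreal_mult'[symmetric] ennreal_mult''[symmetric] field_simps)
    also have "\<dots> = (\<integral>\<^sup>+\<rho>. ennreal (\<rho> ^ (m + 1) * v \<rho>) \<partial>lebesgue)"
      by (simp add: nn_integral_completion)
    also have "\<dots> = (\<integral>\<^sup>+\<rho>. ennreal (\<rho> ^ (m + 1) * w1 \<rho>) \<partial>lebesgue)"
      by (intro nn_integral_cong_AE) (use AE_completion[OF v_eq] in eventually_elim, simp)
    also have "\<dots> = ennreal (LINT \<rho>|lebesgue. \<rho> ^ (m + 1) * w1 \<rho>)"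
    proof (rule nn_integral_eq_integral)
      show "integrable lebesgue (\<lambda>\<rho>. \<rho> ^ (m + 1) * w1 \<rho>)"
      proof (rule Bochner_Integration.integrable_bound[OF w1_int])
        show "(\<lambda>\<rho>. \<rho> ^ (m + 1) * w1 \<rho>) \<in> borel_measurable lebesgue"
          by (intro borel_measurable_times borel_measurable_integrable[OF w1_int]
              measurable_completion) simp
        show "AE \<rho> in lebesgue. norm (\<rho> ^ (m + 1) * w1 \<rho>) \<le> norm (w1 \<rho>)"
        proof (intro AE_I2)
          fix \<rho> :: real
          show "norm (\<rho> ^ (m + 1) * w1 \<rho>) \<le> norm (w1 \<rho>)"
            using power_le_one[of \<rho> "m + 1"] mult_right_mono[of "\<rho> ^ (m + 1)" 1 "w1 \<rho>"] w1_nonneg[of \<rho>]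
            by (cases "\<rho> \<in> {0..<1}") (auto simp: w1_def abs_mult)
        qed
      qed
      show "AE \<rho> in lebesgue. 0 \<le> \<rho> ^ (m + 1) * w1 \<rho>"
      proof (intro AE_I2)
        show "0 \<le> \<rho> ^ (m + 1) * w1 \<rho>" for \<rho>
          using w1_nonneg[of \<rho>] by (cases "\<rho> \<in> {0..<1}") (auto simp: w1_def)
      qed
    qed
    also have "(LINT \<rho>|lebesgue. \<rho> ^ (m + 1) * w1 \<rho>) = weight_moment w m"
      unfolding weight_moment_def set_lebesgue_integral_def
      by (intro Bochner_Integration.integral_cong) (auto simp: w1_def)
    finally show ?thesis .
  qed
  have fin: "finite_measure M"
  proof
    show "emeasure M (space M) \<noteq> \<infinity>"
      using mom[of 0] by (simp add: nn_integral_const)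
  qed
  have rot: "distr M borel ((*) \<omega>) = M" if "cmod \<omega> = 1" for \<omega>
  proof (rule measure_eqI)
    fix A assume "A \<in> sets (distr M borel ((*) \<omega>))"
    then have [measurable]: "A \<in> sets borel" by simp
    have "emeasure M A = (\<integral>\<^sup>+z. ennreal (v (cmod z) / (2 * pi)) * indicator A z \<partial>lborel)"
      unfolding M_def by (subst emeasure_density) auto
    also have "\<dots> = (\<integral>\<^sup>+z. ennreal (v (cmod z) / (2 * pi)) * indicator A z \<partial>distr lborel borel ((*) \<omega>))"
      by (simp only: distr_lborel_mult_unimodular[OF that])
    also have "\<dots> = (\<integral>\<^sup>+z. ennreal (v (cmod z) / (2 * pi)) * indicator A (\<omega> * z) \<partial>lborel)"
      using that by (subst nn_integral_distr) (auto simp: norm_mult)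
    also have "\<dots> = (\<integral>\<^sup>+z. indicator A (\<omega> * z) \<partial>M)"
      unfolding M_def by (subst nn_integral_density) auto
    also have "\<dots> = (\<integral>\<^sup>+z. indicator A z \<partial>distr M borel ((*) \<omega>))"
      by (subst nn_integral_distr) (auto simp: M_def)
    also have "\<dots> = emeasure (distr M borel ((*) \<omega>)) A"
      by simp
    finally show "emeasure (distr M borel ((*) \<omega>)) A = emeasure M A" ..
  qed (simp add: sets)
  have disc: "AE z in M. 0 < cmod z \<and> cmod z < 1"
    unfolding M_def by (subst AE_density, measurable)
      (use AE_lborel_singleton[of "0::complex"] in \<open>eventually_elim, auto simp: v_def indicator_def\<close>)
  have transfer: "set_integrable lebesgue (ball 0 1) (\<lambda>z. h z * w (cmod z)) \<longleftrightarrow> integrable M h"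
    "1 / (2 * pi) * (LINT z:ball 0 1|lebesgue. h z * w (cmod z)) = (LINT z|M. h z)"
    if h [measurable]: "h \<in> borel_measurable borel" for h :: "complex \<Rightarrow> real"
  proof -
    have H_meas: "(\<lambda>z. h z * v (cmod z)) \<in> borel_measurable lborel" by measurable
    have ae: "AE z in lebesgue. indicator (ball 0 1) z *\<^sub>R (h z * w (cmod z)) = h z * v (cmod z)"
      using AE_completion[OF vz_eq]
      by eventually_elim (auto simp: w1_def indicator_def)
    have meas: "(\<lambda>z. indicator (ball 0 1) z *\<^sub>R (h z * w (cmod z))) \<in> borel_measurable lebesgue"
      by (rule borel_measurable_AE[OF measurable_completion[OF H_meas]])
        (use ae in \<open>eventually_elim, metis\<close>)
    show "set_integrable lebesgue (ball 0 1) (\<lambda>z. h z * w (cmod z)) \<longleftrightarrow> integrable M h"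
    proof -
      have "set_integrable lebesgue (ball 0 1) (\<lambda>z. h z * w (cmod z))
          \<longleftrightarrow> integrable lebesgue (\<lambda>z. h z * v (cmod z))"
        unfolding set_integrable_def
        by (rule integrable_cong_AE[OF meas measurable_completion[OF H_meas] ae])
      also have "\<dots> \<longleftrightarrow> integrable lborel (\<lambda>z. (v (cmod z) / (2 * pi)) *\<^sub>R h z)"
      proof -
        have "(\<lambda>z. (v (cmod z) / (2 * pi)) *\<^sub>R h z) = (\<lambda>z. 1 / (2 * pi) * (h z * v (cmod z)))"
          by auto
        then show ?thesis
          by (simp only: integrable_completion[OF H_meas] integrable_mult_left_iff) simp
      qed
      also have "\<dots> \<longleftrightarrow> integrable M h"
        unfolding M_def by (subst integrable_density) (auto simp: v_nonneg)
      finally show ?thesis .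
    qed
    have "(LINT z:ball 0 1|lebesgue. h z * w (cmod z)) = (LINT z|lebesgue. h z * v (cmod z))"
      unfolding set_lebesgue_integral_def
      by (rule integral_cong_AE[OF meas measurable_completion[OF H_meas] ae])
    also have "\<dots> = (LINT z|lborel. (2 * pi) * ((v (cmod z) / (2 * pi)) *\<^sub>R h z))"
      by (simp add: integral_completion mult.commute)
    also have "\<dots> = 2 * pi * (LINT z|M. h z)"
      unfolding M_def by (subst integral_density) (auto simp: v_nonneg)
    finally show "1 / (2 * pi) * (LINT z:ball 0 1|lebesgue. h z * w (cmod z)) = (LINT z|M. h z)"
      by simp
  qed
  have "bergman_measure w M"
    by (rule bergman_measure.intro[OF fin sets rot disc mom transfer])
  then show ?thesis ..
qed

text \<open>
  If some moment vanished, a positive function would have integral \<open>0\<close>, so \<open>M\<close> would be the zero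
  measure, contradicting the normalization of the moment \<open>0\<close>.
\<close>

lemma weight_moment_pos:
  assumes w: "bergman_weight w"
  shows "0 < weight_moment w m"
proof (rule ccontr)
  assume nonpos: "\<not> 0 < weight_moment w m"
  obtain M where "bergman_measure w M" using bergman_measure_exists[OF w] by blast
  then interpret bergman_measure w M .
  note [measurable_cong] = sets
  have "(\<integral>\<^sup>+z. ennreal (cmod z ^ m) \<partial>M) = 0" using nonpos by (simp add: moment ennreal_neg)
  then have "AE z in M. ennreal (cmod z ^ m) = 0" by (subst (asm) nn_integral_0_iff_AE) measurable
  with punctured_disc have "AE z in M. ennreal (cmod z ^ 0) = 0"
    by eventually_elim auto
  then have "(\<integral>\<^sup>+z. ennreal (cmod z ^ 0) \<partial>M) = 0"
    by (subst nn_integral_0_iff_AE) measurable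
  then show False using w by (simp only: moment) (simp add: bergman_weight_def)
qed

section \<open>Bergman norms and contractive dilations\<close>

context bergman_measure
begin

lemma parseval:
  assumes "\<And>z. cmod z < 1 \<Longrightarrow> (\<lambda>k. a k * z ^ k) sums f z"
  shows "(\<integral>\<^sup>+z. ennreal ((cmod (f z))\<^sup>2) \<partial>M)
    = (\<Sum>k. ennreal (weight_moment w (2 * k) * (cmod (a k))\<^sup>2))"
proof -
  have "AE z in M. cmod z < 1"
    using punctured_disc by eventually_elim simp
  from parseval_rotation_invariant[OF finite sets rotation this assms]
  show ?thesis by (simp add: moment ennreal_mult''[symmetric] mult.commute)
qed

lemma bergman_space_iff_norm_eq:
  assumes f: "f holomorphic_on ball 0 1" and p: "0 < p"
  shows "f \<in> bergman_space w p \<longleftrightarrow> (\<integral>\<^sup>+z. ennreal (cmod (f z) powr p) \<partial>M) < \<infinity>"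
    and "bergman_norm w p f = enn2real (\<integral>\<^sup>+z. ennreal (cmod (f z) powr p) \<partial>M) powr (1 / p)"
proof -
  note [measurable_cong] = sets
  \<comment> \<open>\<open>f\<close> is arbitrary outside the disc; cutting it off makes it Borel measurable.\<close>
  define h where "h z = cmod (indicator (ball 0 1) z *\<^sub>R f z) powr p" for z
  have "(\<lambda>z. indicator (ball 0 1) z *\<^sub>R f z) \<in> borel_measurable borel"
    by (rule borel_measurable_continuous_on_indicator[OF unit_disc_borel holomorphic_on_imp_continuous_on[OF f]])
  then have h_meas: "h \<in> borel_measurable borel"
    unfolding h_def by measurable
  have h_meas_M [measurable]: "h \<in> borel_measurable M"
    using h_meas by measurable
  have h_eq: "h z = cmod (f z) powr p" if "z \<in> ball 0 1" for z
    using that by (simp add: h_def)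
  have nn: "(\<integral>\<^sup>+z. ennreal (cmod (f z) powr p) \<partial>M) = (\<integral>\<^sup>+z. ennreal (h z) \<partial>M)"
    by (intro nn_integral_cong_AE, use punctured_disc in eventually_elim) (simp add: h_eq)
  have h_nonneg: "0 \<le> h z" for z by (simp add: h_def)
  have "set_integrable lebesgue (ball 0 1) (\<lambda>z. cmod (f z) powr p * w (cmod z))
      \<longleftrightarrow> set_integrable lebesgue (ball 0 1) (\<lambda>z. h z * w (cmod z))"
    by (rule set_integrable_cong) (simp_all add: h_eq)
  then have "f \<in> bergman_space w p \<longleftrightarrow> set_integrable lebesgue (ball 0 1) (\<lambda>z. h z * w (cmod z))"
    using f by (simp add: bergman_space_def)
  also have "\<dots> \<longleftrightarrow> (\<integral>\<^sup>+z. ennreal (h z) \<partial>M) < \<infinity>"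
    unfolding integrable[OF h_meas] integrable_iff_bounded using h_nonneg by simp
  finally show "f \<in> bergman_space w p \<longleftrightarrow> (\<integral>\<^sup>+z. ennreal (cmod (f z) powr p) \<partial>M) < \<infinity>"
    by (simp add: nn)
  have "(LINT z:ball 0 1|lebesgue. cmod (f z) powr p * w (cmod z))
      = (LINT z:ball 0 1|lebesgue. h z * w (cmod z))"
    by (intro set_lebesgue_integral_cong) (auto simp: h_eq)
  then have "bergman_norm w p f = (LINT z|M. h z) powr (1 / p)"
    unfolding bergman_norm_def by (simp only: integral[OF h_meas])
  also have "(LINT z|M. h z) = enn2real (\<integral>\<^sup>+z. ennreal (h z) \<partial>M)"
    by (rule integral_eq_nn_integral) (use h_nonneg in auto)
  finally show "bergman_norm w p f = enn2real (\<integral>\<^sup>+z. ennreal (cmod (f z) powr p) \<partial>M) powr (1 / p)"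
    by (simp add: nn)
qed

end

lemma fps_power_sums:
  fixes F :: "complex fps"
  assumes F: "\<And>z. cmod z < 1 \<Longrightarrow> (\<lambda>k. fps_nth F k * z ^ k) sums f z" and z: "cmod z < 1"
  shows "(\<lambda>k. fps_nth (F ^ n) k * z ^ k) sums (f z ^ n)"
proof -
  have rad: "fps_conv_radius F \<ge> 1"
    unfolding fps_conv_radius_def
  proof (rule conv_radius_geI_ex)
    fix r :: real assume "0 < r" "ereal r < 1"
    then show "\<exists>z. norm z = r \<and> summable (\<lambda>n. fps_nth F n * z ^ n)"
      using F[of "complex_of_real r"] by (intro exI[of _ "complex_of_real r"]) (auto simp: sums_iff)
  qed
  have z1: "ereal (norm z) < fps_conv_radius F"
    by (rule less_le_trans[OF _ rad]) (use z in simp)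
  then have "ereal (norm z) < fps_conv_radius (F ^ n)"
    using fps_conv_radius_power[of F n] by (rule less_le_trans)
  then have "(\<lambda>k. fps_nth (F ^ n) k * z ^ k) sums eval_fps (F ^ n) z"
    by (rule sums_eval_fps)
  also have "eval_fps (F ^ n) z = f z ^ n"
    using eval_fps_power[OF z1] F[OF z] by (simp add: eval_fps_def sums_iff)
  finally show ?thesis .
qed

lemma norm_powr_double:
  fixes x :: complex
  assumes "n \<ge> 1"
  shows "cmod x powr (2 * real n) = (cmod (x ^ n))\<^sup>2"
proof (cases "x = 0")
  case False
  have "cmod x powr (2 * real n) = cmod x powr real (2 * n)" by simp
  also have "\<dots> = cmod x ^ (2 * n)" using False by (intro powr_realpow) simp
  finally show ?thesis by (simp add: norm_power power_mult[symmetric] mult.commute)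
qed (use assms in simp)

text \<open>
  Both sides agree at \<open>x = 0\<close>, so the inequality passes to the right derivatives there.
\<close>

lemma le_of_one_plus_le_power:
  fixes A :: real
  assumes "\<And>x. 0 < x \<Longrightarrow> 1 + A * x \<le> (1 + x) ^ n"
  shows "A \<le> real n"
proof -
  have "((\<lambda>x::real. (1 + x) ^ n) has_field_derivative real n) (at 0)"
    by (auto intro!: derivative_eq_intros)
  then have "((\<lambda>x::real. ((1 + x) ^ n - 1) / x) \<longlongrightarrow> real n) (at 0)"
    by (simp add: has_field_derivative_iff)
  then have "((\<lambda>x::real. ((1 + x) ^ n - 1) / x) \<longlongrightarrow> real n) (at_right 0)"
    by (rule filterlim_mono) (auto simp: at_within_le_at)
  moreover have "eventually (\<lambda>x::real. A \<le> ((1 + x) ^ n - 1) / x) (at_right 0)"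
    unfolding eventually_at_right_field
  proof (intro exI[of _ 1] conjI allI impI)
    fix x :: real assume "0 < x" "x < 1"
    then show "A \<le> ((1 + x) ^ n - 1) / x" using assms[of x] by (simp add: field_simps)
  qed simp
  ultimately show ?thesis
    by (rule tendsto_lowerbound) simp
qed

context bergman_measure
begin

text \<open>
  For an even exponent \<open>2 * n\<close> the integral is that of the square of the holomorphic function
  \<open>dilation r f z ^ n\<close>, whose coefficients are those of \<open>F ^ n\<close> times \<open>r ^ k\<close>.
\<close>

lemma dilation_power_parseval:
  fixes F :: "complex fps"
  assumes F: "\<And>z. cmod z < 1 \<Longrightarrow> (\<lambda>k. fps_nth F k * z ^ k) sums f z"
    and n: "n \<ge> 1" and r: "0 < r" "r < 1"
  shows "(\<integral>\<^sup>+z. ennreal (cmod (dilation r f z) powr (2 * real n)) \<partial>M)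
    = (\<Sum>k. ennreal (weight_moment w (2 * k) * (cmod (fps_nth (F ^ n) k))\<^sup>2 * r ^ (2 * k)))"
proof -
  have "(\<lambda>k. fps_nth (F ^ n) k * complex_of_real r ^ k * z ^ k) sums (dilation r f z ^ n)"
    if "cmod z < 1" for z
  proof -
    have "cmod (complex_of_real r * z) < 1"
      using that r mult_strict_mono[of r 1 "cmod z" 1] by (simp add: norm_mult)
    from fps_power_sums[OF F this] show ?thesis
      by (simp add: dilation_def power_mult_distrib mult.assoc)
  qed
  from parseval[OF this]
  have "(\<integral>\<^sup>+z. ennreal ((cmod (dilation r f z ^ n))\<^sup>2) \<partial>M)
    = (\<Sum>k. ennreal (weight_moment w (2 * k)
        * (cmod (fps_nth (F ^ n) k * complex_of_real r ^ k))\<^sup>2))" .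
  moreover have "(cmod (b * complex_of_real r ^ k))\<^sup>2 = (cmod b)\<^sup>2 * r ^ (2 * k)" for b k
    using r by (simp add: norm_mult norm_power power_mult_distrib mult.commute flip: power_mult)
  ultimately show ?thesis
    by (simp only: norm_powr_double[OF n] mult.assoc)
qed

lemma holomorphic_dilation:
  assumes f: "f holomorphic_on ball 0 1" and r: "0 < r" "r < 1"
  shows "dilation r f holomorphic_on ball 0 1"
  unfolding dilation_def
proof (rule holomorphic_on_compose_gen[OF _ f, unfolded o_def])
  show "(\<lambda>z. complex_of_real r * z) holomorphic_on ball 0 1"
    by (intro holomorphic_intros)
  show "(\<lambda>z. complex_of_real r * z) ` ball 0 1 \<subseteq> ball 0 1"
  proof
    fix y assume "y \<in> (\<lambda>z. complex_of_real r * z) ` ball 0 1"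
    then obtain z where "cmod z < 1" "y = complex_of_real r * z" by auto
    then show "y \<in> ball 0 1"
      using r mult_strict_mono[of r 1 "cmod z" 1] by (simp add: norm_mult)
  qed
qed

text \<open>
  Since \<open>r\<^sup>2 \<le> 1 / n\<close>, the factors \<open>r ^ (2 * k)\<close> from the dilation are at most the factors
  \<open>1 / n ^ k\<close> for which the coefficient bound for \<open>F ^ n\<close> holds. The bound also shows that the
  integral is finite, that is, membership of the dilated function.
\<close>

lemma dilation_contractive:
  assumes pos: "\<And>m. 0 < weight_moment w m"
    and sup: "\<And>i j. weight_moment w (2 * (i + j))
      \<le> real ((i + j) choose i) * weight_moment w (2 * i) * weight_moment w (2 * j)"
    and n: "n \<ge> 1" and r: "0 < r" "r < 1" "r \<le> 1 / sqrt (real n)"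
    and f: "f \<in> bergman_space w 2"
  shows "dilation r f \<in> bergman_space w (2 * real n)"
    and "bergman_norm w (2 * real n) (dilation r f) \<le> bergman_norm w 2 f"
proof -
  have hol: "f holomorphic_on ball 0 1" using f by (simp add: bergman_space_def)
  define c where "c k = weight_moment w (2 * k)" for k
  define F where "F = fps_expansion f 0"
  have F: "(\<lambda>k. fps_nth F k * z ^ k) sums f z" if "cmod z < 1" for z
    using holomorphic_power_series[OF hol, of z] that by (simp add: F_def fps_expansion_def)
  have norm2: "(\<integral>\<^sup>+z. ennreal (cmod (f z) powr 2) \<partial>M) = (\<Sum>k. ennreal (c k * (cmod (fps_nth F k))\<^sup>2))"
    using parseval[OF F] by (simp add: c_def)
  have c_pos: "0 < c k" for k by (simp add: c_def pos)
  have nonneg: "0 \<le> c k * (cmod (fps_nth F k))\<^sup>2" for k by (simp add: less_imp_le[OF c_pos])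
  have "(\<Sum>k. ennreal (c k * (cmod (fps_nth F k))\<^sup>2)) \<noteq> top"
    using f bergman_space_iff_norm_eq(1)[OF hol, of 2] unfolding norm2 by (simp add: less_top)
  then have summ: "summable (\<lambda>k. c k * (cmod (fps_nth F k))\<^sup>2)"
    by (rule summable_suminf_not_top[OF nonneg])
  define J where "J = (\<Sum>k. c k * (cmod (fps_nth F k))\<^sup>2)"
  have J: "(\<integral>\<^sup>+z. ennreal (cmod (f z) powr 2) \<partial>M) = ennreal J" and J_nonneg: "0 \<le> J"
    unfolding norm2 J_def by (rule suminf_ennreal2[OF nonneg summ], rule suminf_nonneg[OF summ nonneg])
  have bound: "summable (\<lambda>k. c k * (cmod (fps_nth (F ^ n) k))\<^sup>2 / real n ^ k)"
    "(\<Sum>k. c k * (cmod (fps_nth (F ^ n) k))\<^sup>2 / real n ^ k) \<le> J ^ n"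
    using weighted_power_coefficient_bound[OF c_pos _ summ n] sup unfolding J_def c_def by auto
  define I where "I = (\<integral>\<^sup>+z. ennreal (cmod (dilation r f z) powr (2 * real n)) \<partial>M)"
  have r2: "r\<^sup>2 \<le> 1 / real n"
    using power_mono[OF r(3), of 2] r n by (simp add: power_divide)
  have "I = (\<Sum>k. ennreal (c k * (cmod (fps_nth (F ^ n) k))\<^sup>2 * r ^ (2 * k)))"
    unfolding I_def c_def by (rule dilation_power_parseval[OF F n r(1,2)])
  also have "\<dots> \<le> (\<Sum>k. ennreal (c k * (cmod (fps_nth (F ^ n) k))\<^sup>2 / real n ^ k))"
  proof (intro suminf_le ennreal_leI allI summableI)
    fix k
    have "r ^ (2 * k) \<le> (1 / real n) ^ k"
      unfolding power_mult using r2 by (intro power_mono) auto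
    then have "c k * (cmod (fps_nth (F ^ n) k))\<^sup>2 * r ^ (2 * k)
        \<le> c k * (cmod (fps_nth (F ^ n) k))\<^sup>2 * (1 / real n) ^ k"
      using c_pos[of k] by (intro mult_left_mono) auto
    then show "c k * (cmod (fps_nth (F ^ n) k))\<^sup>2 * r ^ (2 * k) \<le> c k * (cmod (fps_nth (F ^ n) k))\<^sup>2 / real n ^ k"
      by (simp add: power_one_over)
  qed
  also have "\<dots> = ennreal (\<Sum>k. c k * (cmod (fps_nth (F ^ n) k))\<^sup>2 / real n ^ k)"
    by (rule suminf_ennreal2[OF _ bound(1)]) (simp add: less_imp_le[OF c_pos])
  also have "\<dots> \<le> ennreal (J ^ n)"
    by (rule ennreal_leI[OF bound(2)])
  finally have I_le: "I \<le> ennreal (J ^ n)" .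
  note g = bergman_space_iff_norm_eq[OF holomorphic_dilation[OF hol r(1,2)], of "2 * real n", folded I_def]
  show "dilation r f \<in> bergman_space w (2 * real n)"
    using g(1) n le_less_trans[OF I_le] by simp
  have "enn2real I \<le> J ^ n"
    using enn2real_mono[OF I_le] J_nonneg by simp
  then have "enn2real I powr (1 / (2 * real n)) \<le> (J ^ n) powr (1 / (2 * real n))"
    by (intro powr_mono2) auto
  also have "\<dots> = J powr (1 / 2)"
  proof (cases "J = 0")
    case False
    then have "J ^ n = J powr real n" using J_nonneg by (simp add: powr_realpow)
    then show ?thesis using n by (simp add: powr_powr)
  qed (use n in simp)
  finally show "bergman_norm w (2 * real n) (dilation r f) \<le> bergman_norm w 2 f"
    using g(2) n bergman_space_iff_norm_eq(2)[OF hol, of 2] J J_nonneg by simp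
qed

text \<open>
  The functions \<open>1 + \<epsilon> * z\<close> detect the critical radius to first order in \<open>\<epsilon>\<^sup>2\<close>. With
  \<open>x = weight_moment w 2 * \<epsilon>\<^sup>2\<close>, contractivity bounds the integral for exponent \<open>2 * n\<close> by
  \<open>(1 + x) ^ n\<close>, while its first two Parseval terms already give \<open>1 + n\<^sup>2 * r\<^sup>2 * x\<close>.
\<close>

lemma radius_bound_from_affine_functions:
  assumes c0: "weight_moment w 0 = 1" and pos: "\<And>m. 0 < weight_moment w m"
    and n: "n \<ge> 1" and r: "0 < r" "r < 1"
    and contr: "\<And>f. f \<in> bergman_space w 2 \<Longrightarrow> dilation r f \<in> bergman_space w (2 * real n) \<and>
        bergman_norm w (2 * real n) (dilation r f) \<le> bergman_norm w 2 f"
  shows "r \<le> 1 / sqrt (real n)"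
proof -
  have "1 + (real n)\<^sup>2 * r\<^sup>2 * x \<le> (1 + x) ^ n" if x: "0 < x" for x
  proof -
    \<comment> \<open>Chosen so that the squared norm of \<open>1 + \<epsilon> * z\<close> is \<open>1 + x\<close>.\<close>
    define \<epsilon> where "\<epsilon> = sqrt (x / weight_moment w 2)"
    have \<epsilon>: "weight_moment w 2 * \<epsilon>\<^sup>2 = x"
      using x pos[of 2] by (simp add: \<epsilon>_def)
    define f where "f z = 1 + complex_of_real \<epsilon> * z" for z
    define F where "F = Abs_fps (\<lambda>k. if k = 0 then 1 else if k = Suc 0 then complex_of_real \<epsilon> else 0)"
    have F: "(\<lambda>k. fps_nth F k * z ^ k) sums f z" for z
      using sums_finite[of "{0, Suc 0}" "\<lambda>k. fps_nth F k * z ^ k"] by (simp add: F_def f_def)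
    have hol: "f holomorphic_on ball 0 1"
      unfolding f_def by (intro holomorphic_intros)
    have "(\<integral>\<^sup>+z. ennreal (cmod (f z) powr 2) \<partial>M)
        = (\<Sum>k. ennreal (weight_moment w (2 * k) * (cmod (fps_nth F k))\<^sup>2))"
      using parseval[OF F] by simp
    also have "\<dots> = (\<Sum>k\<in>{0, Suc 0}. ennreal (weight_moment w (2 * k) * (cmod (fps_nth F k))\<^sup>2))"
      by (rule suminf_finite) (auto simp: F_def)
    also have "\<dots> = ennreal (1 + x)"
      using x by (simp add: F_def c0 \<epsilon> flip: ennreal_plus)
    finally have norm2: "(\<integral>\<^sup>+z. ennreal (cmod (f z) powr 2) \<partial>M) = ennreal (1 + x)" .
    have enn: "enn2real (ennreal (1 + x)) = 1 + x"
      by (rule enn2real_ennreal) (use x in simp)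
    note f2 = bergman_space_iff_norm_eq[OF hol, of 2, unfolded norm2 enn]
    define I where "I = (\<integral>\<^sup>+z. ennreal (cmod (dilation r f z) powr (2 * real n)) \<partial>M)"
    note g = bergman_space_iff_norm_eq[OF holomorphic_dilation[OF hol r], of "2 * real n", folded I_def]
    have "f \<in> bergman_space w 2" using f2 by simp
    from contr[OF this] have I_fin: "I < \<infinity>"
      and le: "enn2real I powr (1 / (2 * real n)) \<le> (1 + x) powr (1 / 2)"
      using f2 g n x by simp_all
    have "enn2real I \<le> (1 + x) ^ n"
    proof (cases "enn2real I = 0")
      case False
      then have "enn2real I = (enn2real I powr (1 / (2 * real n))) powr (2 * real n)"
        using n by (simp add: powr_powr less_le)
      also have "\<dots> \<le> ((1 + x) powr (1 / 2)) powr (2 * real n)"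
        by (intro powr_mono2 le) auto
      also have "\<dots> = (1 + x) ^ n"
        using x by (simp add: powr_powr powr_realpow)
      finally show ?thesis .
    qed (use x in simp)
    have F0: "fps_nth F 0 = 1" and F1: "fps_nth F (Suc 0) = \<epsilon>"
      by (simp_all add: F_def)
    note F01 = fps_power_nth_0_1[OF F0, unfolded F1]
    have linear: "weight_moment w (2 * Suc 0) * (cmod (of_nat n * complex_of_real \<epsilon>))\<^sup>2 * r ^ (2 * Suc 0)
        = (real n)\<^sup>2 * r\<^sup>2 * x"
      by (simp add: norm_mult power_mult_distrib mult_ac flip: \<epsilon>)
    have "ennreal (1 + (real n)\<^sup>2 * r\<^sup>2 * x)
        = (\<Sum>k\<in>{0, Suc 0}. ennreal (weight_moment w (2 * k) * (cmod (fps_nth (F ^ n) k))\<^sup>2 * r ^ (2 * k)))"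
      using x by (simp add: F01 c0 linear del: mult_Suc_right)
    also have "\<dots> \<le> (\<Sum>k. ennreal (weight_moment w (2 * k) * (cmod (fps_nth (F ^ n) k))\<^sup>2 * r ^ (2 * k)))"
      by (intro sum_le_suminf) auto
    also have "\<dots> = I"
      unfolding I_def by (rule dilation_power_parseval[OF F n r, symmetric])
    finally have "enn2real (ennreal (1 + (real n)\<^sup>2 * r\<^sup>2 * x)) \<le> enn2real I"
      using I_fin by (intro enn2real_mono) auto
    moreover have "enn2real (ennreal (1 + (real n)\<^sup>2 * r\<^sup>2 * x)) = 1 + (real n)\<^sup>2 * r\<^sup>2 * x"
      by (rule enn2real_ennreal) (use x in simp)
    ultimately show ?thesis
      using \<open>enn2real I \<le> (1 + x) ^ n\<close> by linarith
  qed
  then have "(real n)\<^sup>2 * r\<^sup>2 \<le> real n"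
    by (rule le_of_one_plus_le_power)
  then have "r\<^sup>2 \<le> 1 / real n"
    using n by (simp add: power2_eq_square field_simps)
  then have "sqrt (r\<^sup>2) \<le> sqrt (1 / real n)" by (rule real_sqrt_le_mono)
  then show ?thesis using r by (simp add: real_sqrt_divide)
qed

end

theorem theorem1p1:
  fixes w :: "real \<Rightarrow> real"
  assumes "bergman_weight w"
    and "\<And>m::nat. m \<ge> 1 \<Longrightarrow>
      weight_moment w (2 * m) / weight_moment w (2 * (m - 1))
        \<ge> real m / (real m + 1) * (weight_moment w (2 * (m + 1)) / weight_moment w (2 * m))"
  shows "\<forall>n::nat. \<forall>r::real. n \<ge> 1 \<and> 0 < r \<and> r < 1 \<longrightarrow>
    ((\<forall>f \<in> bergman_space w 2.
        dilation r f \<in> bergman_space w (2 * real n) \<and>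
        bergman_norm w (2 * real n) (dilation r f) \<le> bergman_norm w 2 f)
     \<longleftrightarrow> r \<le> 1 / sqrt (real n))"
proof -
  obtain M where "bergman_measure w M" using bergman_measure_exists[OF assms(1)] by blast
  then interpret bergman_measure w M .
  have c0: "weight_moment w 0 = 1" using assms(1) by (simp add: bergman_weight_def)
  note pos = weight_moment_pos[OF assms(1)]
  have sup: "weight_moment w (2 * (i + j))
      \<le> real ((i + j) choose i) * weight_moment w (2 * i) * weight_moment w (2 * j)" for i j
    by (rule binomially_supermultiplicative[of "\<lambda>k. weight_moment w (2 * k)"])
      (use pos c0 assms(2) in auto)
  show ?thesis
    using dilation_contractive[OF pos sup] radius_bound_from_affine_functions[OF c0 pos] by blast
qed

end
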